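(* Let $\lambda$ be a nonzero real number. For every integer $n\ge0$, \[ J_{n,\lambda}(x)=\sum_{m=0}^{n}B_{m,\lambda}(x)\,S_{2,\lambda}(n,m), \] and in particular $J_{n,\lambda}=\sum_{m=0}^{n}B_{m,\lambda}S_{2,\lambda}(n,m)$.
   Context: For a nonzero real $\lambda$, set $(x)_{0,\lambda}=1$ and $(x)_{n,\lambda}=x(x-\lambda)\cdots(x-(n-1)\lambda)$ for $n\ge1$. Let $e_\lambda^x(t)=\sum_{n\ge0}(x)_{n,\lambda}\frac{t^n}{n!}=(1+\lambda t)^{x/\lambda}$ and $e_\lambda(t)=e_\lambda^1(t)$. The degenerate Stirling numbers of the second kind are defined by $\frac{1}{k!}(e_\lambda(t)-1)^k=\sum_{n\ge k}S_{2,\lambda}(n,k)\frac{t^n}{n!}$. The degenerate Bell polynomials are defined by $e_\lambda^x(e_\lambda(t)-1)=\sum_{n\ge0}B_{n,\lambda}(x)\frac{t^n}{n!}$, with $B_{n,\lambda}=B_{n,\lambda}(1)$. The Jindalrae polynomials are defined by $e_\lambda^x\big(e_\lambda(e_\lambda(t)-1)-1\big)=\sum_{n\ge0}J_{n,\lambda}(x)\frac{t^n}{n!}$, with $J_{n,\lambda}=J_{n,\lambda}(1)$. *)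

theory Defs
  imports Complex_Main "HOL-Computational_Algebra.Formal_Power_Series"
begin

definition deg_ffact :: "real \<Rightarrow> real \<Rightarrow> nat \<Rightarrow> real" where
  "deg_ffact lam x n = (\<Prod>i<n. x - of_nat i * lam)"

definition deg_exp :: "real \<Rightarrow> real \<Rightarrow> real fps" where
  "deg_exp lam x = Abs_fps (\<lambda>n. deg_ffact lam x n / fact n)"

text \<open>The closed form \<open>(1 + \<lambda>t)\<^bsup>x/\<lambda>\<^esup>\<close>, read as a formal binomial series.\<close>

lemma deg_exp_eq_binomial:
  assumes "lam \<noteq> 0"
  shows "deg_exp lam x = fps_binomial (x / lam) oo (fps_const lam * fps_X)"
proof (rule fps_ext)
  fix n
  have "deg_ffact lam x n = lam ^ n * (\<Prod>i<n. x / lam - of_nat i)"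
    using assms by (induction n) (simp_all add: deg_ffact_def field_simps)
  then show "fps_nth (deg_exp lam x) n =
      fps_nth (fps_binomial (x / lam) oo (fps_const lam * fps_X)) n"
    by (simp add: deg_exp_def fps_compose_linear gbinomial_prod_rev atLeast0LessThan)
qed

definition deg_Stirling2 :: "real \<Rightarrow> nat \<Rightarrow> nat \<Rightarrow> real" where
  "deg_Stirling2 lam n k =
     fact n * fps_nth (fps_const (1 / fact k) * (deg_exp lam 1 - 1) ^ k) n"

text \<open>The generating function of \<open>deg_Stirling2 lam _ k\<close> has no terms of order below \<open>k\<close>.\<close>

lemma deg_Stirling2_eq_0:
  assumes "n < k"
  shows "deg_Stirling2 lam n k = 0"
proof -
  have "fps_nth (deg_exp lam 1 - 1) 0 = 0"
    by (simp add: deg_exp_def deg_ffact_def)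
  then have "fps_nth ((deg_exp lam 1 - 1) ^ k) n = 0"
    using assms startsby_zero_power_prefix by blast
  then show ?thesis by (simp add: deg_Stirling2_def)
qed

text \<open>All compositions below are with series whose constant coefficient is 0.\<close>

definition deg_Bell_poly :: "real \<Rightarrow> nat \<Rightarrow> real \<Rightarrow> real" where
  "deg_Bell_poly lam n x =
     fact n * fps_nth (deg_exp lam x oo (deg_exp lam 1 - 1)) n"

definition deg_Bell :: "real \<Rightarrow> nat \<Rightarrow> real" where
  "deg_Bell lam n = deg_Bell_poly lam n 1"

definition Jindalrae_poly :: "real \<Rightarrow> nat \<Rightarrow> real \<Rightarrow> real" where
  "Jindalrae_poly lam n x =
     fact n * fps_nth (deg_exp lam x oo ((deg_exp lam 1 oo (deg_exp lam 1 - 1)) - 1)) n"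

definition Jindalrae :: "real \<Rightarrow> nat \<Rightarrow> real" where
  "Jindalrae lam n = Jindalrae_poly lam n 1"

end

theory Submission
  imports Defs
begin

text \<open>With f = \<open>deg_exp lam 1 - 1\<close>, the Jindalrae series is E(f(f(t))), E =
  \<open>deg_exp lam x\<close>. Regrouped as (E o f) o f, it is the Bell series evaluated at f; its
  expansion in powers of f brings in f^m / m!, the Stirling series.\<close>

lemma deg_exp_minus_1_nth_0: "fps_nth (deg_exp lam x - 1) 0 = 0"
  by (simp add: deg_exp_def deg_ffact_def)

text \<open>Associativity of composition applies because f has zero constant term.\<close>

lemma Jindalrae_poly_eq_Bell_compose:
  "Jindalrae_poly lam n x =
     fact n * fps_nth ((deg_exp lam x oo (deg_exp lam 1 - 1)) oo (deg_exp lam 1 - 1)) n"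
proof -
  let ?f = "deg_exp lam 1 - 1"
  have "(deg_exp lam 1 oo ?f) - 1 = ?f oo ?f"
    by (simp add: fps_compose_sub_distrib)
  then show ?thesis
    by (simp only: Jindalrae_poly_def
        fps_compose_assoc[OF deg_exp_minus_1_nth_0 deg_exp_minus_1_nth_0])
qed

lemma Jindalrae_poly_eq_sum_Bell_Stirling:
  "Jindalrae_poly lam n x = (\<Sum>m=0..n. deg_Bell_poly lam m x * deg_Stirling2 lam n m)"
  \<comment> \<open>The pattern expands only the outer composition, so the inner one stays
    recognisable as the Bell series; the factors m! then cancel termwise.\<close>
  unfolding Jindalrae_poly_eq_Bell_compose fps_compose_nth[of "_ oo _"] sum_distrib_left
  by (rule sum.cong) (simp_all add: deg_Bell_poly_def deg_Stirling2_def)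

theorem theorem10:
  fixes lam :: real and n :: nat
  assumes "lam \<noteq> 0"
  shows "(\<forall>x::real. Jindalrae_poly lam n x =
            (\<Sum>m=0..n. deg_Bell_poly lam m x * deg_Stirling2 lam n m)) \<and>
         Jindalrae lam n = (\<Sum>m=0..n. deg_Bell lam m * deg_Stirling2 lam n m)"
  by (simp add: Jindalrae_def deg_Bell_def Jindalrae_poly_eq_sum_Bell_Stirling)

end
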